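(* Let $\mathcal{A}$, $\mathcal{B}$, and $\mathcal{C}$ be unital $C^*$-algebras, let $\omega:\mathcal{A}\to\mathcal{C}$ be a Schwarz-positive unital (SPU) map, and let $F:\mathcal{B}\to\mathcal{A}$ be a linear (not necessarily $*$-preserving) map. Then $$F(B^*B)-F(B)^*F(B)\in\mathcal{N}_{\omega}\qquad\text{for all }B\in\mathcal{B}$$ if and only if $F$ is right $\omega$-a.e. deterministic, i.e. $$F(B^*C)-F(B)^*F(C)\in\mathcal{N}_{\omega}\qquad\text{for all }B,C\in\mathcal{B}.$$ Diagrammatically (string diagrams written out algebraically), the equivalence reads: $\omega\big(A\,F(B^* )F(B)\big)=\omega\big(A\,F(B^*B)\big)$ for all $A\in\mathcal{A}$, $B\in\mathcal{B}$ if and only if $\omega\big(A\,F(B_1)F(B_2)\big)=\omega\big(A\,F(B_1B_2)\big)$ for all $A\in\mathcal{A}$, $B_1,B_2\in\mathcal{B}$. An analogous condition holds for left $\omega$-a.e. determinism, with the appropriate morphisms appearing on the left instead of the right.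
   Context: A linear map $\omega:\mathcal{A}\to\mathcal{C}$ of unital $C^*$-algebras is Schwarz-positive unital (SPU) if it is unital and $\omega(A^*A)\ge\omega(A)^*\omega(A)$ for all $A\in\mathcal{A}$. The right nullspace of $\omega$ is $\mathcal{N}_\omega:=\{A\in\mathcal{A}:\omega(A^*A)=0\}$, and the left nullspace is ${}_\omega\mathcal{N}:=\{A\in\mathcal{A}:\omega(AA^* )=0\}$. A linear map $F:\mathcal{B}\to\mathcal{A}$ is right $\omega$-a.e. deterministic if $\omega\big(A\,F(B_1)F(B_2)\big)=\omega\big(A\,F(B_1B_2)\big)$ for all $A\in\mathcal{A}$, $B_1,B_2\in\mathcal{B}$, and left $\omega$-a.e. deterministic if $\omega\big(F(B_1)F(B_2)\,A\big)=\omega\big(F(B_1B_2)\,A\big)$ for all such $A,B_1,B_2$. A linear map $F$ is $*$-preserving if $F(B^* )=F(B)^*$ for all $B$.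
   Formalization: Both displayed equivalences are proved for all linear F, but identifying the conditions with F(B)* with a.e. determinism, false for general F, is proved only for *-preserving F, or for general F with F(B)* replaced by F(B* ); likewise for the left version. *)

theory Defs
  imports Complex_Main
begin

class scaleC =
  fixes scaleC :: "complex \<Rightarrow> 'a \<Rightarrow> 'a"  (infixr \<open>*\<^sub>C\<close> 75)

class adj =
  fixes adj :: "'a \<Rightarrow> 'a"

text \<open>
  Unital C*-algebras. Extending \<^class>\<open>monoid_mult\<close> rather than
  \<^class>\<open>real_normed_algebra_1\<close> keeps the zero algebra; in any other instance
  \<open>norm 1 = 1\<close> follows from the C*-identity. The real normed structure of the
  library classes is tied to the complex one by \<open>scaleR_scaleC\<close>.
\<close>

class unital_cstar_algebra = banach + real_normed_algebra + monoid_mult + scaleC + adj +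
  assumes scaleC_add_right: "c *\<^sub>C (x + y) = c *\<^sub>C x + c *\<^sub>C y"
    and scaleC_add_left: "(c + d) *\<^sub>C x = c *\<^sub>C x + d *\<^sub>C x"
    and scaleC_scaleC: "c *\<^sub>C (d *\<^sub>C x) = (c * d) *\<^sub>C x"
    and scaleC_one: "1 *\<^sub>C x = x"
    and scaleR_scaleC: "r *\<^sub>R x = complex_of_real r *\<^sub>C x"
    and norm_scaleC: "norm (c *\<^sub>C x) = cmod c * norm x"
    and mult_scaleC_left: "(c *\<^sub>C x) * y = c *\<^sub>C (x * y)"
    and mult_scaleC_right: "x * (c *\<^sub>C y) = c *\<^sub>C (x * y)"
    and adj_adj: "adj (adj x) = x"
    and adj_add: "adj (x + y) = adj x + adj y"
    and adj_scaleC: "adj (c *\<^sub>C x) = cnj c *\<^sub>C adj x"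
    and adj_mult: "adj (x * y) = adj y * adj x"
    and cstar_identity: "norm (adj x * x) = (norm x)\<^sup>2"

lemma vector_space_scaleC:
  "vector_space (scaleC :: complex \<Rightarrow> 'a \<Rightarrow> 'a::unital_cstar_algebra)"
  by unfold_locales (simp_all add: scaleC_add_right scaleC_add_left scaleC_scaleC scaleC_one)

instantiation complex :: unital_cstar_algebra
begin

definition scaleC_complex :: "complex \<Rightarrow> complex \<Rightarrow> complex"
  where "scaleC_complex c x = c * x"

definition adj_complex :: "complex \<Rightarrow> complex"
  where "adj_complex x = cnj x"

instance
  by standard (simp_all add: scaleC_complex_def adj_complex_def algebra_simps
      scaleR_conv_of_real norm_mult power2_eq_square)

end

abbreviation clinear :: "('a::unital_cstar_algebra \<Rightarrow> 'b::unital_cstar_algebra) \<Rightarrow> bool"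
  where "clinear \<equiv> Vector_Spaces.linear scaleC scaleC"

text \<open>The order of a C*-algebra: its positive elements are those of the form \<open>adj c * c\<close>.\<close>

definition cstar_le :: "'a::unital_cstar_algebra \<Rightarrow> 'a \<Rightarrow> bool"
  where "cstar_le x y \<longleftrightarrow> (\<exists>c. y - x = adj c * c)"

definition SPU :: "('a::unital_cstar_algebra \<Rightarrow> 'c::unital_cstar_algebra) \<Rightarrow> bool"
  where "SPU \<omega> \<longleftrightarrow> clinear \<omega> \<and> \<omega> 1 = 1 \<and> (\<forall>A. cstar_le (adj (\<omega> A) * \<omega> A) (\<omega> (adj A * A)))"

definition right_nullspace :: "('a::unital_cstar_algebra \<Rightarrow> 'c::unital_cstar_algebra) \<Rightarrow> 'a set"
  where "right_nullspace \<omega> = {A. \<omega> (adj A * A) = 0}"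

definition left_nullspace :: "('a::unital_cstar_algebra \<Rightarrow> 'c::unital_cstar_algebra) \<Rightarrow> 'a set"
  where "left_nullspace \<omega> = {A. \<omega> (A * adj A) = 0}"

definition right_ae_deterministic ::
    "('a::unital_cstar_algebra \<Rightarrow> 'c::unital_cstar_algebra) \<Rightarrow> ('b::unital_cstar_algebra \<Rightarrow> 'a) \<Rightarrow> bool"
  where "right_ae_deterministic \<omega> F \<longleftrightarrow> (\<forall>A B1 B2. \<omega> (A * F B1 * F B2) = \<omega> (A * F (B1 * B2)))"

definition left_ae_deterministic ::
    "('a::unital_cstar_algebra \<Rightarrow> 'c::unital_cstar_algebra) \<Rightarrow> ('b::unital_cstar_algebra \<Rightarrow> 'a) \<Rightarrow> bool"
  where "left_ae_deterministic \<omega> F \<longleftrightarrow> (\<forall>A B1 B2. \<omega> (F B1 * F B2 * A) = \<omega> (F (B1 * B2) * A))"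

definition star_preserving :: "('b::unital_cstar_algebra \<Rightarrow> 'a::unital_cstar_algebra) \<Rightarrow> bool"
  where "star_preserving F \<longleftrightarrow> (\<forall>B. F (adj B) = adj (F B))"

text \<open>
  For a linear map \<open>F\<close> that is not *-preserving, \<open>adj (F B)\<close> and \<open>F (adj B)\<close> differ, and so do
  the conditions built from them: the conditions with \<open>adj (F B)\<close> neither imply nor follow from
  a.e. determinism. Statements about general \<open>F\<close> therefore have to keep the two apart.
\<close>

end

theory Submission
  imports Defs
begin

text \<open>
  An SPU map is positive, and a Cauchy--Schwarz argument shows that its right nullspace consists of
  the \<open>N\<close> with \<open>\<omega> (A N) = 0\<close> for all \<open>A\<close> (its left nullspace, of those with \<open>\<omega> (N A) = 0\<close>).
  Each condition then says that a sesquilinear defect such as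
  \<open>(B, C) \<mapsto> \<omega> (A (F (B\<^sup>* C) - F (B\<^sup>*) F C))\<close> vanishes, and by polarization over the complex
  numbers it vanishes as soon as it does on the diagonal.

  Positivity of \<open>\<omega>\<close> needs that the elements \<open>c\<^sup>* c\<close> form a proper convex cone. No spectral theory is
  used for this: for self-adjoint \<open>x\<close> with \<open>norm x \<le> r\<close>, being the square of a self-adjoint element
  amounts to \<open>norm (r 1 - x) \<le> r\<close>, a condition that is visibly convex and closed.
\<close>

section \<open>Square roots\<close>

interpretation scaleC: vector_space "scaleC :: complex \<Rightarrow> 'a \<Rightarrow> 'a::unital_cstar_algebra"
  by (rule vector_space_scaleC)

lemmas scaleC_minus_left = scaleC.scale_minus_left
lemmas scaleC_minus_right = scaleC.scale_minus_right

section \<open>Elementary identities for the adjoint and the norm\<close>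

lemma adj_zero [simp]: "adj (0::'a::unital_cstar_algebra) = 0"
  using adj_add[of "0::'a" 0] by simp

lemma adj_minus: "adj (- x) = - adj (x::'a::unital_cstar_algebra)"
  using adj_add[of x "- x"] by (simp add: eq_neg_iff_add_eq_0 add.commute)

lemma adj_diff: "adj (x - y) = adj x - adj (y::'a::unital_cstar_algebra)"
  using adj_add[of x "- y"] by (simp add: adj_minus)

lemma adj_scaleR: "adj (r *\<^sub>R x) = r *\<^sub>R adj (x::'a::unital_cstar_algebra)"
  by (simp add: scaleR_scaleC adj_scaleC)

lemma adj_one [simp]: "adj (1::'a::unital_cstar_algebra) = 1"
proof -
  have "adj 1 = adj (1::'a) * adj (adj 1)" by (simp add: adj_adj)
  also have "\<dots> = adj (adj 1 * 1)" by (simp only: adj_mult)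
  also have "\<dots> = (1::'a)" by (simp add: adj_adj)
  finally show ?thesis .
qed

lemmas adj_simps = adj_adj adj_add adj_minus adj_diff adj_scaleR adj_scaleC adj_mult

lemma norm_adj [simp]: "norm (adj x) = norm (x::'a::unital_cstar_algebra)"
proof -
  have le: "norm y \<le> norm (adj y)" for y :: 'a
  proof (cases "norm y = 0")
    case False
    have "norm y * norm y \<le> norm (adj y) * norm y"
      using norm_mult_ineq[of "adj y" y] by (simp add: cstar_identity power2_eq_square)
    then show ?thesis using False by (simp add: mult_le_cancel_right)
  qed simp
  show ?thesis using le[of x] le[of "adj x"] by (simp add: adj_adj)
qed

lemma norm_one_le: "norm (1::'a::unital_cstar_algebra) \<le> 1"
proof -
  have "norm (1::'a) * norm (1::'a) = norm (1::'a)"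
    using cstar_identity[of "1::'a"] by (simp add: power2_eq_square)
  then have "norm (1::'a) = 0 \<or> norm (1::'a) = 1" by simp
  then show ?thesis by linarith
qed

lemma norm_square_selfadjoint:
  "adj h = h \<Longrightarrow> norm (h * h) = (norm (h::'a::unital_cstar_algebra))\<^sup>2"
  using cstar_identity[of h] by simp

lemma adj_mult_self_eq_0_iff [simp]: "adj x * x = 0 \<longleftrightarrow> (x::'a::unital_cstar_algebra) = 0"
  using cstar_identity[of x] by auto

lemma bounded_linear_adj: "bounded_linear (adj :: 'a \<Rightarrow> 'a::unital_cstar_algebra)"
  by (rule bounded_linear_intro[where K = 1]) (simp_all add: adj_simps)

text \<open>The iteration \<open>z \<mapsto> (y + z\<^sup>2) / 2\<close>, whose fixed points are \<open>1 - \<surd>(1 - y)\<close>. It converges on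
  the whole closed unit ball because it is dominated by the scalar iteration with \<open>y = 1\<close>.\<close>

primrec sqrt_iter :: "'a::real_normed_algebra \<Rightarrow> nat \<Rightarrow> 'a" where
  "sqrt_iter y 0 = 0"
| "sqrt_iter y (Suc n) = (1/2) *\<^sub>R (y + sqrt_iter y n * sqrt_iter y n)"

lemma sqrt_iter_commute:
  assumes "w * y = y * w"
  shows "w * sqrt_iter y n = sqrt_iter y n * w"
proof (induction n)
  case (Suc n)
  have "w * (sqrt_iter y n * sqrt_iter y n) = sqrt_iter y n * sqrt_iter y n * w"
    by (metis Suc mult.assoc)
  then show ?case using assms by (simp add: algebra_simps)
qed simp

lemma sqrt_iter_adj:
  fixes y :: "'a::unital_cstar_algebra"
  shows "adj y = y \<Longrightarrow> adj (sqrt_iter y n) = sqrt_iter y n"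
  by (induction n) (simp_all add: adj_simps)

lemma sqrt_iter_one_bounds: "0 \<le> sqrt_iter (1::real) n \<and> sqrt_iter (1::real) n \<le> 1"
proof (induction n)
  case (Suc n)
  then have "sqrt_iter (1::real) n * sqrt_iter (1::real) n \<le> 1 * 1"
    by (intro mult_mono) auto
  with Suc show ?case by simp
qed simp

lemma norm_sqrt_iter_le:
  assumes "norm y \<le> 1"
  shows "norm (sqrt_iter y n) \<le> sqrt_iter (1::real) n"
proof (induction n)
  case (Suc n)
  have "norm (sqrt_iter y n * sqrt_iter y n) \<le> sqrt_iter (1::real) n * sqrt_iter (1::real) n"
    by (rule order_trans[OF norm_mult_ineq]) (intro mult_mono Suc, auto simp: sqrt_iter_one_bounds)
  with assms show ?case
    using norm_triangle_ineq[of y "sqrt_iter y n * sqrt_iter y n"] by simp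
qed simp

text \<open>Consecutive iterates commute, being polynomials in \<open>y\<close>, so the difference
  of their squares factors; each factor is dominated by its scalar counterpart.\<close>

lemma norm_sqrt_iter_diff_le:
  assumes "norm y \<le> 1"
  shows "norm (sqrt_iter y (Suc n) - sqrt_iter y n) \<le> sqrt_iter (1::real) (Suc n) - sqrt_iter 1 n"
proof (induction n)
  case (Suc n)
  let ?z = "sqrt_iter y" and ?t = "sqrt_iter (1::real)"
  have comm: "?z (Suc n) * ?z n = ?z n * ?z (Suc n)"
    by (intro sqrt_iter_commute sqrt_iter_commute[symmetric] refl)
  have "?z (Suc (Suc n)) - ?z (Suc n) = (1/2) *\<^sub>R (?z (Suc n) * ?z (Suc n) - ?z n * ?z n)"
    unfolding sqrt_iter.simps(2)[of y "Suc n"] sqrt_iter.simps(2)[of y n]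
    by (simp add: scaleR_right_diff_distrib[symmetric])
  also have "\<dots> = (1/2) *\<^sub>R ((?z (Suc n) + ?z n) * (?z (Suc n) - ?z n))"
    using comm by (simp add: algebra_simps del: sqrt_iter.simps)
  finally have "norm (?z (Suc (Suc n)) - ?z (Suc n))
      \<le> (1/2) * (norm (?z (Suc n) + ?z n) * norm (?z (Suc n) - ?z n))"
    using norm_mult_ineq[of "?z (Suc n) + ?z n" "?z (Suc n) - ?z n"] by simp
  also have "\<dots> \<le> (1/2) * ((?t (Suc n) + ?t n) * (?t (Suc n) - ?t n))"
  proof -
    have "norm (?z (Suc n) + ?z n) \<le> ?t (Suc n) + ?t n"
      using norm_triangle_ineq[of "?z (Suc n)" "?z n"]
        norm_sqrt_iter_le[OF assms, of n] norm_sqrt_iter_le[OF assms, of "Suc n"] by linarith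
    then show ?thesis
      using Suc sqrt_iter_one_bounds[of n] sqrt_iter_one_bounds[of "Suc n"]
      by (intro mult_left_mono mult_mono) (simp_all del: sqrt_iter.simps)
  qed
  also have "\<dots> = ?t (Suc (Suc n)) - ?t (Suc n)"
    unfolding sqrt_iter.simps(2)[of _ "Suc n"]
    by (simp add: algebra_simps)
  finally show ?case .
qed (use assms in simp)

lemma convergent_sqrt_iter:
  fixes y :: "'a::unital_cstar_algebra"
  assumes "norm y \<le> 1"
  shows "convergent (sqrt_iter y)"
proof -
  let ?t = "sqrt_iter (1::real)"
  \<comment> \<open>With \<open>y = 1\<close> the increment bound says that each scalar increment is
    at least a norm, hence nonnegative.\<close>
  have "incseq ?t"
    using order_trans[OF norm_ge_zero norm_sqrt_iter_diff_le[of "1::real"]]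
    by (intro incseq_SucI) (simp del: sqrt_iter.simps)
  then have "convergent ?t"
    using sqrt_iter_one_bounds by (meson Bseq_monoseq_convergent incseq_imp_monoseq
        incseq_convergent convergentI)
  then have "summable (\<lambda>n. ?t (Suc n) - ?t n)"
    unfolding convergent_def by (blast intro: sums_summable telescope_sums)
  then have "summable (\<lambda>n. sqrt_iter y (Suc n) - sqrt_iter y n)"
    by (rule summable_comparison_test') (rule norm_sqrt_iter_diff_le[OF assms])
  then have "convergent (\<lambda>n. \<Sum>i<n. sqrt_iter y (Suc i) - sqrt_iter y i)"
    by (simp only: summable_iff_convergent)
  then show ?thesis by (simp only: sum_lessThan_telescope sqrt_iter.simps(1) diff_zero)
qed

text \<open>The root is \<open>1 - z\<close> for the limit \<open>z\<close> of the iteration;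
  self-adjointness, the norm bound and commutation pass from the iterates to the limit.\<close>

lemma ex_sqrt_one_minus:
  fixes y :: "'a::unital_cstar_algebra"
  assumes y: "adj y = y" "norm y \<le> 1"
  obtains s where "adj s = s" "s * s = 1 - y" "norm (1 - s) \<le> 1"
    "\<forall>w. w * y = y * w \<longrightarrow> w * s = s * w"
proof -
  obtain z where z: "sqrt_iter y \<longlonglongrightarrow> z"
    using convergent_sqrt_iter[OF y(2)] by (auto simp: convergent_def)
  have "(\<lambda>n. adj (sqrt_iter y n)) \<longlonglongrightarrow> adj z"
    by (rule bounded_linear.tendsto[OF bounded_linear_adj z])
  then have sa: "adj z = z"
    unfolding sqrt_iter_adj[OF y(1)] using z by (rule LIMSEQ_unique)
  have "(\<lambda>n. sqrt_iter y (Suc n)) \<longlonglongrightarrow> (1/2) *\<^sub>R (y + z * z)"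
    unfolding sqrt_iter.simps(2) by (intro tendsto_intros z)
  then have "z = (1/2) *\<^sub>R (y + z * z)"
    using LIMSEQ_unique LIMSEQ_Suc[OF z] by blast
  from arg_cong[OF this, of "scaleR 2"] have "2 *\<^sub>R z = y + z * z" by simp
  then have sq: "(1 - z) * (1 - z) = 1 - y"
    by (simp add: algebra_simps scaleR_2)
  have "norm (sqrt_iter y n) \<le> 1" for n
    using norm_sqrt_iter_le[OF y(2), of n] sqrt_iter_one_bounds[of n] by linarith
  then have "norm z \<le> 1"
    using LIMSEQ_le_const2[OF tendsto_norm[OF z]] by blast
  moreover have "\<forall>w. w * y = y * w \<longrightarrow> w * (1 - z) = (1 - z) * w"
  proof (intro allI impI)
    fix w assume comm: "w * y = y * w"
    have "w * z = z * w"
      using tendsto_mult_left[OF z, of w] tendsto_mult_right[OF z, of w]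
      unfolding sqrt_iter_commute[OF comm] by (rule LIMSEQ_unique)
    then show "w * (1 - z) = (1 - z) * w" by (simp add: left_diff_distrib right_diff_distrib)
  qed
  ultimately show thesis
    by (intro that[of "1 - z"] sq) (simp_all add: adj_diff sa)
qed

text \<open>Rescaling \<open>x = r (1 - y)\<close> reduces this to the unit ball. The bound on
  \<open>s\<close> is the hypothesis again, with \<open>sqrt r\<close> for \<open>r\<close>, so that
  a further root can be taken.\<close>

lemma ex_sqrt:
  fixes x :: "'a::unital_cstar_algebra"
  assumes x: "adj x = x" "norm (r *\<^sub>R 1 - x) \<le> r"
  obtains s where "adj s = s" "s * s = x" "norm (sqrt r *\<^sub>R 1 - s) \<le> sqrt r"
    "\<forall>w. w * x = x * w \<longrightarrow> w * s = s * w"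
proof (cases "r = 0")
  \<comment> \<open>Here the norm bound forces \<open>x = 0\<close>.\<close>
  case True
  then show thesis using x that[of 0] by simp
next
  case False
  then have r: "r > 0" using x(2) norm_ge_zero[of "r *\<^sub>R 1 - x"] by linarith
  define y where "y = 1 - (1 / r) *\<^sub>R x"
  have y_alt: "y = (1 / r) *\<^sub>R (r *\<^sub>R 1 - x)"
    using r by (simp add: y_def scaleR_right_diff_distrib)
  have "adj y = y" using x(1) by (simp add: y_def adj_simps)
  moreover have "norm y \<le> 1" using x(2) r by (simp add: y_alt)
  ultimately obtain s where s: "adj s = s" "s * s = 1 - y" "norm (1 - s) \<le> 1"
    "\<forall>w. w * y = y * w \<longrightarrow> w * s = s * w"
    by (rule ex_sqrt_one_minus)
  show thesis
  proof (rule that[of "sqrt r *\<^sub>R s"])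
    show "adj (sqrt r *\<^sub>R s) = sqrt r *\<^sub>R s" using s(1) by (simp add: adj_simps)
    show "sqrt r *\<^sub>R s * sqrt r *\<^sub>R s = x" using s(2) r by (simp add: y_def)
    have "norm (sqrt r *\<^sub>R 1 - sqrt r *\<^sub>R s) = sqrt r * norm (1 - s)"
      using r by (simp add: scaleR_right_diff_distrib[symmetric])
    then show "norm (sqrt r *\<^sub>R 1 - sqrt r *\<^sub>R s) \<le> sqrt r"
      using s(3) r by (simp add: mult_left_le)
    show "\<forall>w. w * x = x * w \<longrightarrow> w * sqrt r *\<^sub>R s = sqrt r *\<^sub>R s * w"
    proof (intro allI impI)
      fix w assume "w * x = x * w"
      then have "w * y = y * w" by (simp add: y_def left_diff_distrib right_diff_distrib)
      then show "w * sqrt r *\<^sub>R s = sqrt r *\<^sub>R s * w" using s(4) by simp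
    qed
  qed
qed

text \<open>A substitute for monotonicity of the norm on positive elements, available before the
  cone is known to be convex.\<close>

lemma norm_le_commuting_squares:
  fixes h k :: "'a::unital_cstar_algebra"
  assumes sa: "adj h = h" "adj k = k" and comm: "h * k = k * h"
  shows "(norm k)\<^sup>2 \<le> norm (h * h + k * k)"
proof -
  text \<open>\<open>u\<close> is normal, since \<open>h\<close> and \<open>k\<close> commute, with imaginary part \<open>k\<close>.\<close>
  define u where "u = h + \<i> *\<^sub>C k"
  have u': "adj u = h - \<i> *\<^sub>C k"
    using sa by (simp add: u_def adj_simps scaleC_minus_left)
  have "adj u * u = h * h + k * k"
    unfolding u' unfolding u_def
    by (simp add: algebra_simps mult_scaleC_left mult_scaleC_right scaleC_scaleC comm scaleC_minus_left scaleC_one)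
  then have n: "norm (h * h + k * k) = (norm u)\<^sup>2" by (metis cstar_identity)
  have "u - adj u = \<i> *\<^sub>C k + \<i> *\<^sub>C k"
    unfolding u' unfolding u_def by simp
  also have "\<dots> = (2 * \<i>) *\<^sub>C k" by (simp add: scaleC_add_left[symmetric])
  finally have "2 * norm k = norm (u - adj u)" by (simp add: norm_scaleC norm_mult)
  also have "\<dots> \<le> 2 * norm u" using norm_triangle_ineq4[of u "adj u"] by simp
  finally show ?thesis unfolding n by (simp add: power_mono)
qed

section \<open>The positive cone\<close>

text \<open>Unlike the cone behind \<open>cstar_le\<close>, only squares of self-adjoint elements are admitted;
  the two cones agree by \<open>positive_adj_mult_self\<close>.\<close>

definition positive :: "'a::unital_cstar_algebra \<Rightarrow> bool"
  where "positive x \<longleftrightarrow> (\<exists>h. adj h = h \<and> x = h * h)"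

lemma positive_adj: "positive x \<Longrightarrow> adj x = x"
  by (auto simp: positive_def adj_simps)

lemma positive_square: "adj h = h \<Longrightarrow> positive (h * h)"
  by (auto simp: positive_def)

lemma positiveI_norm:
  assumes "adj x = x" "norm (r *\<^sub>R 1 - x) \<le> r"
  shows "positive x"
proof (rule ex_sqrt[OF assms])
  fix s assume "adj s = s" "s * s = x"
  then show "positive x" unfolding positive_def by blast
qed

text \<open>Converse of \<open>positiveI_norm\<close> for large radii. As
  \<open>norm x \<le> r\<close>, the element \<open>r 1 - x\<close> has a root \<open>k\<close>,
  which commutes with the root \<open>h\<close> of \<open>x\<close>; and
  \<open>h * h + k * k = r 1\<close>.\<close>

lemma positive_norm:
  fixes x :: "'a::unital_cstar_algebra"
  assumes "positive x" "norm x \<le> r"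
  shows "norm (r *\<^sub>R 1 - x) \<le> r"
proof -
  obtain h where h: "adj h = h" "x = h * h" using assms by (auto simp: positive_def)
  have "adj (r *\<^sub>R 1 - x) = r *\<^sub>R 1 - x" "norm (r *\<^sub>R 1 - (r *\<^sub>R 1 - x)) \<le> r"
    using assms positive_adj by (simp_all add: adj_simps)
  then obtain k where k: "adj k = k" "k * k = r *\<^sub>R 1 - x"
    "norm (sqrt r *\<^sub>R 1 - k) \<le> sqrt r"
    "\<forall>w. w * (r *\<^sub>R 1 - x) = (r *\<^sub>R 1 - x) * w \<longrightarrow> w * k = k * w"
    by (rule ex_sqrt)
  have "h * k = k * h" by (rule k(4)[rule_format]) (simp add: h algebra_simps)
  then have "(norm k)\<^sup>2 \<le> norm (r *\<^sub>R (1::'a))"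
    using norm_le_commuting_squares[OF h(1) k(1)]
    by (simp only: k(2) h(2)[symmetric] add.commute[of x] diff_add_cancel)
  also have "\<dots> \<le> r"
    using norm_one_le[where 'a = 'a] order_trans[OF norm_ge_zero assms(2)]
    by (simp add: mult_left_le)
  finally show ?thesis
    by (simp only: norm_square_selfadjoint[OF k(1), symmetric] k(2))
qed

text \<open>By the triangle inequality the norm criteria with radii \<open>norm x\<close> and
  \<open>norm y\<close> add up.\<close>

lemma positive_add:
  assumes "positive x" "positive y"
  shows "positive (x + y)"
proof (rule positiveI_norm)
  show "adj (x + y) = x + y" using assms by (simp add: adj_simps positive_adj)
  have "(norm x + norm y) *\<^sub>R 1 - (x + y) = (norm x *\<^sub>R 1 - x) + (norm y *\<^sub>R 1 - y)"
    by (simp add: algebra_simps)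
  then show "norm ((norm x + norm y) *\<^sub>R 1 - (x + y)) \<le> norm x + norm y"
    using positive_norm[OF assms(1) order_refl] positive_norm[OF assms(2) order_refl]
      norm_triangle_mono by metis
qed

lemma positive_scaleR:
  assumes "positive x" "0 \<le> r"
  shows "positive (r *\<^sub>R x)"
proof -
  obtain h where "adj h = h" "x = h * h" using assms by (auto simp: positive_def)
  then have "r *\<^sub>R x = (sqrt r *\<^sub>R h) * (sqrt r *\<^sub>R h)" "adj (sqrt r *\<^sub>R h) = sqrt r *\<^sub>R h"
    using assms by (simp_all add: adj_simps)
  then show ?thesis by (auto simp: positive_def)
qed

lemma positive_antisym:
  assumes "positive x" "positive (- x)"
  shows "x = 0"
proof -
  obtain k where k: "adj k = k" "x = k * k" using assms by (auto simp: positive_def)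
  \<comment> \<open>An arbitrary root of \<open>- x\<close> need not commute with \<open>k\<close>;
    the one from \<open>ex_sqrt\<close> does, because \<open>k\<close> commutes with
    \<open>k * k\<close>.\<close>
  obtain h where h: "adj h = h" "h * h = - x"
    "norm (sqrt (norm (- x)) *\<^sub>R 1 - h) \<le> sqrt (norm (- x))"
    "\<forall>w. w * (- x) = - x * w \<longrightarrow> w * h = h * w"
    by (rule ex_sqrt[OF positive_adj[OF assms(2)] positive_norm[OF assms(2) order_refl]])
  have "k * h = h * k" by (rule h(4)[rule_format]) (simp add: k mult.assoc)
  then have "(norm k)\<^sup>2 \<le> 0"
    using norm_le_commuting_squares[OF h(1) k(1)] by (simp add: h(2) k(2)[symmetric])
  then show ?thesis by (simp add: k)
qed

text \<open>The radius \<open>norm h + norm k\<close> serves all \<open>e \<le> 1\<close> at once,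
  so the norm criterion survives the limit as \<open>e\<close> tends to 0.\<close>

lemma positive_closed_ray:
  assumes "\<And>e. 0 < e \<Longrightarrow> positive (h + e *\<^sub>R k)" and k: "positive k"
  shows "positive h"
proof (rule positiveI_norm)
  have "adj (h + 1 *\<^sub>R k) = h + 1 *\<^sub>R k" by (intro positive_adj assms(1)) simp
  then show "adj h = h" using positive_adj[OF k] by (simp add: adj_simps)
  let ?R = "norm h + norm k"
  show "norm (?R *\<^sub>R 1 - h) \<le> ?R"
  proof (rule field_le_epsilon)
    fix d :: real assume d: "0 < d"
    \<comment> \<open>The 1 keeps \<open>e\<close> in the range of the common radius, the quotient
      gives \<open>e * norm k \<le> d\<close>, and \<open>norm k + 1\<close> avoids a zero
      denominator.\<close>
    define e where "e = min 1 (d / (norm k + 1))"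
    have e: "0 < e" "e \<le> 1" using d by (auto simp: e_def add_nonneg_pos)
    have "e * (norm k + 1) \<le> d"
      using d by (simp add: e_def pos_le_divide_eq[symmetric] add_nonneg_pos)
    then have ek: "e * norm k \<le> d" using e by (simp add: algebra_simps)
    have "norm (h + e *\<^sub>R k) \<le> ?R"
      using norm_triangle_ineq[of h "e *\<^sub>R k"] e mult_right_mono[of e 1 "norm k"] by simp
    then have "norm (?R *\<^sub>R 1 - (h + e *\<^sub>R k)) \<le> ?R"
      by (rule positive_norm[OF assms(1)[OF e(1)]])
    moreover have "?R *\<^sub>R 1 - h = (?R *\<^sub>R 1 - (h + e *\<^sub>R k)) + e *\<^sub>R k" by simp
    ultimately show "norm (?R *\<^sub>R 1 - h) \<le> ?R + d"
      using ek e norm_triangle_ineq[of "?R *\<^sub>R 1 - (h + e *\<^sub>R k)" "e *\<^sub>R k"] by simp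
  qed
qed

text \<open>Up to real factors \<open>a\<close> and \<open>b\<close> are the real and imaginary
  parts of \<open>z\<close>, and \<open>a * a + b * b\<close> is twice the claimed element.\<close>

lemma positive_adj_mult_self_add: "positive (adj z * z + z * adj (z::'a::unital_cstar_algebra))"
proof -
  define a b where "a = z + adj z" and "b = \<i> *\<^sub>C (z - adj z)"
  have "adj b = b"
    unfolding b_def adj_scaleC adj_diff adj_adj using scaleC_minus_right[of "\<i>" "z - adj z"] by (simp add: scaleC_minus_left)
  moreover have "b * b = - ((z - adj z) * (z - adj z))"
    by (simp add: b_def mult_scaleC_left mult_scaleC_right scaleC_scaleC scaleC_minus_left scaleC_one)
  moreover have "adj a = a" by (simp add: a_def adj_simps add.commute)
  ultimately have "positive (a * a + - ((z - adj z) * (z - adj z)))"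
    by (metis positive_add positive_square)
  also have "a * a + - ((z - adj z) * (z - adj z)) = 2 *\<^sub>R (adj z * z + z * adj z)"
    by (simp add: a_def algebra_simps scaleR_2)
  finally have "positive ((1/2) *\<^sub>R (2 *\<^sub>R (adj z * z + z * adj z)))"
    by (rule positive_scaleR) simp
  then show ?thesis by simp
qed

text \<open>Nothing is known about the sign of \<open>y * adj y\<close>. Passing to
  \<open>z = k * adj y\<close>, with \<open>k * k = - (adj y * y)\<close>, makes both
  \<open>z * adj z\<close> and \<open>adj z * z\<close> negatives of squares.\<close>

lemma adj_mult_self_negative_imp_zero:
  fixes y :: "'a::unital_cstar_algebra"
  assumes "positive (- (adj y * y))"
  shows "y = 0"
proof -
  obtain k where k: "adj k = k" "- (adj y * y) = k * k" using assms by (auto simp: positive_def)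
  then have yy: "adj y * y = - (k * k)" by (metis minus_minus)
  define z where "z = k * adj y"
  have "z * adj z = k * (adj y * y) * k"
    by (simp add: z_def adj_simps k mult.assoc)
  then have 1: "z * adj z = - ((k * k) * (k * k))" by (simp add: yy mult.assoc)
  have "adj z * z = y * (k * k) * adj y" by (simp add: z_def adj_simps k mult.assoc)
  also have "\<dots> = - (y * adj y * (y * adj y))"
    by (simp add: k(2)[symmetric] mult.assoc)
  finally have 2: "adj z * z = - (y * adj y * (y * adj y))" .
  have p1: "positive (- (z * adj z))"
    unfolding 1 minus_minus by (rule positive_square) (simp add: adj_simps k)
  have p2: "positive (- (adj z * z))"
    unfolding 2 minus_minus by (rule positive_square) (simp add: adj_simps)
  \<comment> \<open>The sum lies in the cone with both signs, so it vanishes; hence each summand is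
    minus the other and also lies there with both signs.\<close>
  have "positive (- (adj z * z + z * adj z))" using positive_add[OF p1 p2] by (simp add: algebra_simps)
  then have "adj z * z + z * adj z = 0" using positive_antisym positive_adj_mult_self_add by blast
  then have "z * adj z = - (adj z * z)" by (simp add: eq_neg_iff_add_eq_0 add.commute)
  then have "z * adj z = 0" using p1 p2 positive_antisym by metis
  then have "adj (k * k) * (k * k) = 0" using 1 k by (simp add: adj_simps)
  then have "k * k = 0" by (simp only: adj_mult_self_eq_0_iff)
  then show ?thesis using yy by simp
qed

text \<open>With \<open>h = c\<^sup>* c\<close> and \<open>q = |h| - h\<close> (twice the negative part of \<open>h\<close>), the square
  \<open>(c q)\<^sup>* (c q) = - |h| q\<^sup>2\<close> is negative, which forces \<open>c q = 0\<close> and then \<open>q = 0\<close>.\<close>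

lemma positive_adj_mult_self:
  fixes c :: "'a::unital_cstar_algebra"
  shows "positive (adj c * c)"
proof -
  define h where "h = adj c * c"
  have h: "adj h = h" by (simp add: h_def adj_simps)
  \<comment> \<open>\<open>m\<close> plays the role of \<open>|h|\<close>.\<close>
  obtain m where m: "adj m = m" "m * m = h * h"
    "norm (sqrt (norm (h * h)) *\<^sub>R 1 - m) \<le> sqrt (norm (h * h))"
    "\<forall>w. w * (h * h) = h * h * w \<longrightarrow> w * m = m * w"
    by (rule ex_sqrt[OF positive_adj[OF positive_square[OF h]]
        positive_norm[OF positive_square[OF h] order_refl]])
  have hm: "h * m = m * h" by (rule m(4)[rule_format]) (simp add: mult.assoc)
  \<comment> \<open>The norm bound obtained with \<open>m\<close> permits a second root, which shows
    that \<open>m\<close> is positive and commutes with \<open>q\<close>.\<close>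
  obtain s where s: "adj s = s" "s * s = m"
    "norm (sqrt (sqrt (norm (h * h))) *\<^sub>R 1 - s) \<le> sqrt (sqrt (norm (h * h)))"
    "\<forall>w. w * m = m * w \<longrightarrow> w * s = s * w"
    by (rule ex_sqrt[OF m(1) m(3)])
  define q where "q = m - h"
  have q: "adj q = q" by (simp add: q_def adj_simps m(1) h)
  have qs: "q * s = s * q"
    by (rule s(4)[rule_format]) (simp add: q_def left_diff_distrib right_diff_distrib hm)
  have hq: "h * q = - (m * q)" by (simp add: q_def right_diff_distrib hm m(2))
  have "adj (c * q) * (c * q) = q * (h * q)" by (simp add: adj_simps q h_def mult.assoc)
  also have "\<dots> = - (q * (s * s) * q)" by (simp add: hq s(2) mult.assoc)
  also have "\<dots> = - ((s * q) * (s * q))" by (metis qs mult.assoc)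
  finally have "- (adj (c * q) * (c * q)) = (s * q) * (s * q)" by simp
  moreover have "adj (s * q) = s * q" by (simp add: adj_simps q s(1) qs)
  ultimately have "c * q = 0" using adj_mult_self_negative_imp_zero positive_square by metis
  then have "h * q = 0" by (simp add: h_def mult.assoc)
  then have "m * q = 0" using hq by simp
  have "q * q = m * q - h * q" by (simp add: q_def algebra_simps)
  then have "adj q * q = 0" using \<open>h * q = 0\<close> \<open>m * q = 0\<close> q by simp
  then have "q = 0" by (simp only: adj_mult_self_eq_0_iff)
  then have "h = s * s" by (simp add: q_def s(2))
  then show ?thesis using positive_square[OF s(1)] by (simp add: h_def)
qed

section \<open>Nullspaces and polarization\<close>

lemma clinear_add: "clinear f \<Longrightarrow> f (x + y) = f x + f y"
  by (simp add: Vector_Spaces.linear_def module_hom_def module_hom_axioms_def)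

lemma clinear_scaleC: "clinear f \<Longrightarrow> f (c *\<^sub>C x) = c *\<^sub>C f x"
  by (simp add: Vector_Spaces.linear_def module_hom_def module_hom_axioms_def)

text \<open>The values \<open>c = 1\<close> and \<open>c = \<i>\<close> suffice. Here complex
  scalars are essential: real ones would give only \<open>P + Q = 0\<close>.\<close>

lemma conjugate_pair_eq_0:
  fixes P Q :: "'c::unital_cstar_algebra"
  assumes "\<And>c. c *\<^sub>C P + cnj c *\<^sub>C Q = 0"
  shows "P = 0" "Q = 0"
proof -
  have 1: "Q = - P" using assms[of 1] by (simp add: scaleC_one eq_neg_iff_add_eq_0 add.commute)
  have "\<i> *\<^sub>C P + \<i> *\<^sub>C P = 0"
    using assms[of \<i>] by (simp add: 1 scaleC_minus_left scaleC_minus_right)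
  then have "(2 * \<i>) *\<^sub>C P = 0" by (simp add: scaleC_add_left[symmetric])
  then show "P = 0" by simp
  then show "Q = 0" using 1 by simp
qed

section \<open>Sesquilinear maps and polarization\<close>

definition sesquilinear ::
    "('b::unital_cstar_algebra \<Rightarrow> 'b \<Rightarrow> 'c::unital_cstar_algebra) \<Rightarrow> bool"
  where "sesquilinear S \<longleftrightarrow>
    (\<forall>x y z. S (x + y) z = S x z + S y z) \<and> (\<forall>x y z. S z (x + y) = S z x + S z y) \<and>
    (\<forall>c x y. S (c *\<^sub>C x) y = cnj c *\<^sub>C S x y) \<and> (\<forall>c x y. S x (c *\<^sub>C y) = c *\<^sub>C S x y)"

lemma sesquilinear_expand:
  assumes "sesquilinear S"
  shows "S (x + c *\<^sub>C y) (x + c *\<^sub>C y) =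
    S x x + (c *\<^sub>C S x y + cnj c *\<^sub>C S y x) + (cnj c * c) *\<^sub>C S y y"
  using assms by (simp add: sesquilinear_def scaleC_scaleC scaleC_add_right algebra_simps)

text \<open>Expanding the diagonal value at \<open>x + c y\<close> leaves only the cross terms,
  which form a conjugate pair in \<open>c\<close>.\<close>

lemma sesquilinear_eq_0:
  assumes S: "sesquilinear S" and "\<And>x. S x x = 0"
  shows "S x y = 0"
proof (rule conjugate_pair_eq_0(1))
  show "c *\<^sub>C S x y + cnj c *\<^sub>C S y x = 0" for c
    using sesquilinear_expand[OF S, of x c y] assms(2) by simp
qed

lemma sesquilinear_diff:
  "sesquilinear S \<Longrightarrow> sesquilinear T \<Longrightarrow> sesquilinear (\<lambda>x y. S x y - T x y)"
  by (simp add: sesquilinear_def scaleC.scale_right_diff_distrib)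

lemma sesquilinear_comp_clinear:
  "clinear f \<Longrightarrow> sesquilinear S \<Longrightarrow> sesquilinear (\<lambda>x y. f (S x y))"
  by (simp add: sesquilinear_def clinear_add clinear_scaleC)

lemma sesquilinear_adj_mult: "sesquilinear (\<lambda>x y. adj x * y)"
  by (simp add: sesquilinear_def adj_simps algebra_simps mult_scaleC_left mult_scaleC_right)

lemma sesquilinear_mult_left: "sesquilinear S \<Longrightarrow> sesquilinear (\<lambda>x y. a * S x y)"
  by (simp add: sesquilinear_def algebra_simps mult_scaleC_right)

lemma sesquilinear_mult_right: "sesquilinear S \<Longrightarrow> sesquilinear (\<lambda>x y. S x y * a)"
  by (simp add: sesquilinear_def algebra_simps mult_scaleC_left)

section \<open>Schwarz-positive unital maps and their nullspaces\<close>

lemma SPU_positive: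
  assumes "SPU \<omega>"
  shows "positive (\<omega> (adj A * A))"
proof -
  obtain c where "\<omega> (adj A * A) - adj (\<omega> A) * \<omega> A = adj c * c"
    using assms unfolding SPU_def cstar_le_def by blast
  then have "\<omega> (adj A * A) = adj c * c + adj (\<omega> A) * \<omega> A" by (simp add: diff_eq_eq)
  then show ?thesis by (simp add: positive_add positive_adj_mult_self)
qed

text \<open>Positivity of \<open>\<omega> ((X + c N)\<^sup>* (X + c N))\<close> for every complex \<open>c\<close> leaves no room
  for the terms linear in \<open>c\<close> when the quadratic one vanishes.\<close>

lemma SPU_null_mult:
  assumes SPU: "SPU \<omega>" and N: "\<omega> (adj N * N) = 0"
  shows "\<omega> (adj X * N) = 0" "\<omega> (adj N * X) = 0"
proof -
  have lin: "clinear \<omega>" using SPU by (simp add: SPU_def)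
  define H where "H c = c *\<^sub>C \<omega> (adj X * N) + cnj c *\<^sub>C \<omega> (adj N * X)" for c
  have pos: "positive (\<omega> (adj X * X) + H c)" for c
    using SPU_positive[OF SPU, of "X + c *\<^sub>C N"] N
      sesquilinear_expand[OF sesquilinear_comp_clinear[OF lin sesquilinear_adj_mult], of X c N]
    by (simp add: H_def)
  have H_pos: "positive (H c)" for c
  proof (rule positive_closed_ray)
    show "positive (\<omega> (adj X * X))" by (rule SPU_positive[OF SPU])
    \<comment> \<open>\<open>H\<close> is homogeneous over the reals: evaluating at
      \<open>c / e\<close> and multiplying by \<open>e\<close> leaves \<open>H c\<close> unchanged
      and shrinks the constant term.\<close>
    fix e :: real assume "0 < e"
    then have "e *\<^sub>R (\<omega> (adj X * X) + H (of_real (1 / e) * c)) = H c + e *\<^sub>R \<omega> (adj X * X)"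
      by (simp add: H_def scaleR_scaleC scaleC_add_right scaleC_scaleC add.commute)
    then show "positive (H c + e *\<^sub>R \<omega> (adj X * X))"
      using positive_scaleR[OF pos, of e] \<open>0 < e\<close> by (metis less_imp_le)
  qed
  \<comment> \<open>As \<open>H\<close> is odd, its values lie in the cone with both signs.\<close>
  have "H (- c) = - H c" for c by (simp add: H_def scaleC_minus_left)
  then have "H c = 0" for c using H_pos positive_antisym by metis
  then have "c *\<^sub>C \<omega> (adj X * N) + cnj c *\<^sub>C \<omega> (adj N * X) = 0" for c by (simp add: H_def)
  then show "\<omega> (adj X * N) = 0" "\<omega> (adj N * X) = 0" by (rule conjugate_pair_eq_0)+
qed

text \<open>Membership is the case \<open>A = adj N\<close>. The right-hand side is linear in
  \<open>N\<close>, as polarization requires, whereas the defining condition is quadratic.\<close>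

lemma right_nullspace_iff:
  assumes "SPU \<omega>"
  shows "N \<in> right_nullspace \<omega> \<longleftrightarrow> (\<forall>A. \<omega> (A * N) = 0)"
  using SPU_null_mult(1)[OF assms] by (auto simp: right_nullspace_def) (metis adj_adj)

lemma left_nullspace_iff:
  assumes "SPU \<omega>"
  shows "N \<in> left_nullspace \<omega> \<longleftrightarrow> (\<forall>A. \<omega> (N * A) = 0)"
  using SPU_null_mult(2)[OF assms, of "adj N"] by (auto simp: left_nullspace_def adj_adj)

lemma sesquilinear_in_right_nullspace_iff:
  assumes "SPU \<omega>" "sesquilinear S"
  shows "(\<forall>x. S x x \<in> right_nullspace \<omega>) \<longleftrightarrow> (\<forall>x y. S x y \<in> right_nullspace \<omega>)"
proof -
  have "sesquilinear (\<lambda>x y. \<omega> (A * S x y))" for A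
    by (rule sesquilinear_comp_clinear[OF _ sesquilinear_mult_left[OF assms(2)]])
      (use assms(1) in \<open>simp add: SPU_def\<close>)
  from sesquilinear_eq_0[OF this] show ?thesis
    unfolding right_nullspace_iff[OF assms(1)] by blast
qed

lemma sesquilinear_in_left_nullspace_iff:
  assumes "SPU \<omega>" "sesquilinear S"
  shows "(\<forall>x. S x x \<in> left_nullspace \<omega>) \<longleftrightarrow> (\<forall>x y. S x y \<in> left_nullspace \<omega>)"
proof -
  have "sesquilinear (\<lambda>x y. \<omega> (S x y * A))" for A
    by (rule sesquilinear_comp_clinear[OF _ sesquilinear_mult_right[OF assms(2)]])
      (use assms(1) in \<open>simp add: SPU_def\<close>)
  from sesquilinear_eq_0[OF this] show ?thesis
    unfolding left_nullspace_iff[OF assms(1)] by blast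
qed

theorem lemma6p7:
  fixes \<omega> :: "'a::unital_cstar_algebra \<Rightarrow> 'c::unital_cstar_algebra"
    and F :: "'b::unital_cstar_algebra \<Rightarrow> 'a"
  assumes "SPU \<omega>" and "clinear F"
  shows
    "((\<forall>B. F (adj B * B) - adj (F B) * F B \<in> right_nullspace \<omega>) \<longleftrightarrow>
        (\<forall>B C. F (adj B * C) - adj (F B) * F C \<in> right_nullspace \<omega>))
     \<and> ((\<forall>A B. \<omega> (A * F (adj B) * F B) = \<omega> (A * F (adj B * B))) \<longleftrightarrow>
        right_ae_deterministic \<omega> F)
     \<and> ((\<forall>B. F (adj B * B) - F (adj B) * F B \<in> right_nullspace \<omega>) \<longleftrightarrow>
        right_ae_deterministic \<omega> F)
     \<and> ((\<forall>B C. F (adj B * C) - F (adj B) * F C \<in> right_nullspace \<omega>) \<longleftrightarrow>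
        right_ae_deterministic \<omega> F)
     \<and> (star_preserving F \<longrightarrow>
        ((\<forall>B. F (adj B * B) - adj (F B) * F B \<in> right_nullspace \<omega>) \<longleftrightarrow>
           right_ae_deterministic \<omega> F) \<and>
        ((\<forall>B C. F (adj B * C) - adj (F B) * F C \<in> right_nullspace \<omega>) \<longleftrightarrow>
           right_ae_deterministic \<omega> F))
     \<and> ((\<forall>B. F (adj B * B) - adj (F B) * F B \<in> left_nullspace \<omega>) \<longleftrightarrow>
        (\<forall>B C. F (adj B * C) - adj (F B) * F C \<in> left_nullspace \<omega>))
     \<and> ((\<forall>B. F (B * adj B) - F B * adj (F B) \<in> left_nullspace \<omega>) \<longleftrightarrow>
        (\<forall>B C. F (B * adj C) - F B * adj (F C) \<in> left_nullspace \<omega>))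
     \<and> ((\<forall>A B. \<omega> (F (adj B) * F B * A) = \<omega> (F (adj B * B) * A)) \<longleftrightarrow>
        left_ae_deterministic \<omega> F)
     \<and> ((\<forall>B. F (adj B * B) - F (adj B) * F B \<in> left_nullspace \<omega>) \<longleftrightarrow>
        left_ae_deterministic \<omega> F)
     \<and> ((\<forall>B C. F (adj B * C) - F (adj B) * F C \<in> left_nullspace \<omega>) \<longleftrightarrow>
        left_ae_deterministic \<omega> F)
     \<and> (star_preserving F \<longrightarrow>
        ((\<forall>B. F (adj B * B) - adj (F B) * F B \<in> left_nullspace \<omega>) \<longleftrightarrow>
           left_ae_deterministic \<omega> F) \<and>
        ((\<forall>B C. F (adj B * C) - adj (F B) * F C \<in> left_nullspace \<omega>) \<longleftrightarrow>
           left_ae_deterministic \<omega> F))"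
proof -
  note SPU = assms(1) and F = assms(2)
  have \<omega>: "clinear \<omega>" using SPU by (simp add: SPU_def)
  have \<omega>_diff: "\<omega> (x - y) = \<omega> x - \<omega> y" for x y
    using clinear_add[OF \<omega>, of "x - y" y] by simp
  have sesq_F: "sesquilinear (\<lambda>B C. F (adj B * C))"
    by (rule sesquilinear_comp_clinear[OF F sesquilinear_adj_mult])
  have sesq_adj: "sesquilinear (\<lambda>B C. F (adj B * C) - adj (F B) * F C)"
    by (rule sesquilinear_diff[OF sesq_F])
      (simp add: sesquilinear_def clinear_add[OF F] clinear_scaleC[OF F] adj_simps
        algebra_simps mult_scaleC_left mult_scaleC_right)
  have sesq: "sesquilinear (\<lambda>B C. F (adj B * C) - F (adj B) * F C)"
    by (rule sesquilinear_diff[OF sesq_F])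
      (simp add: sesquilinear_def clinear_add[OF F] clinear_scaleC[OF F] adj_simps
        algebra_simps mult_scaleC_left mult_scaleC_right)
  \<comment> \<open>The arguments are swapped because the adjoint now falls on \<open>C\<close>,
    which makes the defect conjugate-linear in \<open>C\<close>.\<close>
  have sesq_flip: "sesquilinear (\<lambda>C B. F (B * adj C) - F B * adj (F C))"
    by (simp add: sesquilinear_def clinear_add[OF F] clinear_scaleC[OF F] adj_simps
        algebra_simps mult_scaleC_left mult_scaleC_right scaleC.scale_right_diff_distrib)
  have right_eq: "(\<forall>A. \<omega> (A * F B * F C) = \<omega> (A * F (B * C))) \<longleftrightarrow>
      F (B * C) - F B * F C \<in> right_nullspace \<omega>" for B C
    by (auto simp: right_nullspace_iff[OF SPU] right_diff_distrib \<omega>_diff mult.assoc)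
  have left_eq: "(\<forall>A. \<omega> (F B * F C * A) = \<omega> (F (B * C) * A)) \<longleftrightarrow>
      F (B * C) - F B * F C \<in> left_nullspace \<omega>" for B C
    by (auto simp: left_nullspace_iff[OF SPU] left_diff_distrib \<omega>_diff mult.assoc)
  \<comment> \<open>Every \<open>B1\<close> has the form \<open>adj B\<close>, so determinism may be
    tested with \<open>adj B\<close> as first argument.\<close>
  have right_det: "right_ae_deterministic \<omega> F \<longleftrightarrow>
      (\<forall>B C. F (adj B * C) - F (adj B) * F C \<in> right_nullspace \<omega>)"
    unfolding right_ae_deterministic_def right_eq[symmetric] by (metis adj_adj)
  have left_det: "left_ae_deterministic \<omega> F \<longleftrightarrow>
      (\<forall>B C. F (adj B * C) - F (adj B) * F C \<in> left_nullspace \<omega>)"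
    unfolding left_ae_deterministic_def left_eq[symmetric] by (metis adj_adj)
  have right_diag: "(\<forall>A B. \<omega> (A * F (adj B) * F B) = \<omega> (A * F (adj B * B))) \<longleftrightarrow>
      (\<forall>B. F (adj B * B) - F (adj B) * F B \<in> right_nullspace \<omega>)"
    unfolding right_eq[symmetric] by blast
  have left_diag: "(\<forall>A B. \<omega> (F (adj B) * F B * A) = \<omega> (F (adj B * B) * A)) \<longleftrightarrow>
      (\<forall>B. F (adj B * B) - F (adj B) * F B \<in> left_nullspace \<omega>)"
    unfolding left_eq[symmetric] by blast
  note right_polar = sesquilinear_in_right_nullspace_iff[OF SPU]
    and left_polar = sesquilinear_in_left_nullspace_iff[OF SPU]
  have flip: "(\<forall>B. F (B * adj B) - F B * adj (F B) \<in> left_nullspace \<omega>) \<longleftrightarrow>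
      (\<forall>B C. F (B * adj C) - F B * adj (F C) \<in> left_nullspace \<omega>)"
    using left_polar[OF sesq_flip] by blast
  have star: "adj (F B) = F (adj B)" if "star_preserving F" for B
    using that by (simp add: star_preserving_def)
  \<comment> \<open>Inside the two implications \<open>star\<close> turns the defect with
    \<open>adj (F B)\<close> into the one with \<open>F (adj B)\<close>.\<close>
  show ?thesis
    unfolding right_diag left_diag right_det left_det
    using right_polar[OF sesq_adj] left_polar[OF sesq_adj] right_polar[OF sesq]
      left_polar[OF sesq] flip
    by (simp add: star cong: imp_cong)
qed

end
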